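(* Let $k$ be a positive integer, and let $G$ be a connected graph of order $n$ with minimum degree $\delta$. 1. If $n \geq 2k + 9$ and \[ e(G) \geq e\bigl(K_{2k} \vee (K_{n - 2k - 1} \cup K_1)\bigr), \] then $G$ is fractional $k$-extendable, unless $G \cong K_{2k} \vee (K_{n - 2k - 1} \cup K_1)$. 2. If $n \geq 6\delta$, $\delta \geq 2k + 1$ and \[ e(G) \geq e\bigl(K_{\delta} \vee (K_{n - 2\delta + 2k - 1} \cup (\delta - 2k + 1)K_1)\bigr), \] then $G$ is fractional $k$-extendable, unless $G \cong K_{\delta} \vee (K_{n - 2\delta + 2k - 1} \cup (\delta - 2k + 1)K_1)$.
   Context: All graphs are finite and simple. $e(G)$ denotes the number of edges of $G$. $K_m$ is the complete graph on $m$ vertices, $\cup$ denotes disjoint union of graphs, $tK_1$ is the graph with $t$ vertices and no edges, and the join $G_1 \vee G_2$ is obtained from the disjoint union of $G_1$ and $G_2$ by adding every edge between $V(G_1)$ and $V(G_2)$. A $k$-matching is a set of $k$ pairwise vertex-disjoint edges. A fractional perfect matching of $G$ is a function $h: E(G) \to [0,1]$ such that $\sum_{e \in E_G(v)} h(e) = 1$ for every $v \in V(G)$, where $E_G(v)$ is the set of edges incident with $v$. A graph $G$ with at least $2k+2$ vertices is fractional $k$-extendable if it has a $k$-matching and for every $k$-matching $M$ of $G$ there is a fractional perfect matching $h$ of $G$ with $h(e) = 1$ for all $e \in M$. *)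

theory Defs
  imports Complex_Main "HOL-Library.Disjoint_Sets"
begin

text \<open>An undirected edge is the two-element set of its endpoints.\<close>

record 'a graph =
  verts :: "'a set"
  edges :: "'a set set"

definition finite_simple_graph :: "'a graph \<Rightarrow> bool" where
  "finite_simple_graph G \<longleftrightarrow>
     finite (verts G) \<and> (\<forall>e\<in>edges G. e \<subseteq> verts G \<and> card e = 2)"

definition order :: "'a graph \<Rightarrow> nat" where
  "order G = card (verts G)"

definition num_edges :: "'a graph \<Rightarrow> nat" where
  "num_edges G = card (edges G)"

definition incident_edges :: "'a graph \<Rightarrow> 'a \<Rightarrow> 'a set set" where
  "incident_edges G v = {e \<in> edges G. v \<in> e}"

definition degree :: "'a graph \<Rightarrow> 'a \<Rightarrow> nat" where
  "degree G v = card (incident_edges G v)"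

text \<open>Only meaningful for finite graphs with at least one vertex.\<close>

definition min_degree :: "'a graph \<Rightarrow> nat" where
  "min_degree G = Min (degree G ` verts G)"

definition graph_connected :: "'a graph \<Rightarrow> bool" where
  "graph_connected G \<longleftrightarrow> verts G \<noteq> {} \<and>
     (\<forall>u\<in>verts G. \<forall>v\<in>verts G. (u, v) \<in> {(x, y). {x, y} \<in> edges G}\<^sup>*)"

definition graph_iso :: "'a graph \<Rightarrow> 'b graph \<Rightarrow> bool" where
  "graph_iso G H \<longleftrightarrow>
     (\<exists>f. bij_betw f (verts G) (verts H) \<and>
          (\<forall>u\<in>verts G. \<forall>v\<in>verts G. {u, v} \<in> edges G \<longleftrightarrow> {f u, f v} \<in> edges H))"

definition complete_graph :: "nat \<Rightarrow> nat graph" where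
  "complete_graph m = \<lparr>verts = {..<m}, edges = {e. e \<subseteq> {..<m} \<and> card e = 2}\<rparr>"

definition edgeless_graph :: "nat \<Rightarrow> nat graph" where
  "edgeless_graph t = \<lparr>verts = {..<t}, edges = {}\<rparr>"

definition graph_union :: "'a graph \<Rightarrow> 'b graph \<Rightarrow> ('a + 'b) graph" where
  "graph_union G H = \<lparr>verts = verts G <+> verts H,
     edges = (`) Inl ` edges G \<union> (`) Inr ` edges H\<rparr>"

definition graph_join :: "'a graph \<Rightarrow> 'b graph \<Rightarrow> ('a + 'b) graph" where
  "graph_join G H = \<lparr>verts = verts (graph_union G H),
     edges = edges (graph_union G H) \<union> {{Inl u, Inr v} | u v. u \<in> verts G \<and> v \<in> verts H}\<rparr>"

definition k_matching :: "nat \<Rightarrow> 'a graph \<Rightarrow> 'a set set \<Rightarrow> bool" where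
  "k_matching k G M \<longleftrightarrow> M \<subseteq> edges G \<and> finite M \<and> card M = k \<and> disjoint M"

text \<open>The values of \<open>h\<close> outside the edge set are irrelevant.\<close>

definition fractional_perfect_matching :: "'a graph \<Rightarrow> ('a set \<Rightarrow> real) \<Rightarrow> bool" where
  "fractional_perfect_matching G h \<longleftrightarrow>
     (\<forall>e\<in>edges G. 0 \<le> h e \<and> h e \<le> 1) \<and>
     (\<forall>v\<in>verts G. (\<Sum>e\<in>incident_edges G v. h e) = 1)"

definition fractional_extendable :: "nat \<Rightarrow> 'a graph \<Rightarrow> bool" where
  "fractional_extendable k G \<longleftrightarrow>
     order G \<ge> 2 * k + 2 \<and>
     (\<exists>M. k_matching k G M) \<and>
     (\<forall>M. k_matching k G M \<longrightarrow>
        (\<exists>h. fractional_perfect_matching G h \<and> (\<forall>e\<in>M. h e = 1)))"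

end

theory Submission
  imports Defs
begin

text \<open>
  Suppose that a \<open>k\<close>-matching \<open>M\<close> does not extend to a fractional perfect matching. If the graph
  left uncovered by \<open>M\<close> had a permutation of its vertices that moves every vertex to a neighbour,
  then weight one half on each pair of a vertex and its image, together with weight one on \<open>M\<close>,
  would be such an extension (\<open>fractional_matching_from_injection\<close>). So Hall's condition fails for
  the neighbourhoods, and a violating set yields a barrier
  (\<open>barrier_of_unextendable_matching\<close>): an independent set \<open>I\<close> all of whose neighbours lie in a
  disjoint set \<open>S\<close>, where \<open>\<bar>I\<bar> = \<bar>S\<bar> - 2k + 1\<close>. The set \<open>S\<close> contains the vertices of \<open>M\<close>.

  Hence \<open>G\<close> is a spanning subgraph of \<open>K\<^sub>s \<or> (K\<^sub>r \<union> t K\<^sub>1)\<close> with \<open>s = \<bar>S\<bar>\<close>, \<open>t = s - 2k + 1\<close> and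
  \<open>r = n - s - t\<close>. A vertex of \<open>I\<close> has all its neighbours in \<open>S\<close>, so \<open>s\<close> is at least any lower
  bound \<open>d\<close> for the degrees. As a function of \<open>t\<close>, the edge number of the large graph is a convex
  quadratic; over the range permitted by \<open>s \<ge> d\<close> and \<open>s + t \<le> n\<close> its maximum is attained only at
  \<open>s = d\<close>, as soon as \<open>n + 10k \<ge> 6d + 8\<close> (\<open>barrier_edge_count_strict\<close>). A graph with at least that
  many edges is therefore the extremal graph itself (\<open>extendable_or_barrier_graph\<close>).

  Both parts of the theorem are instances of this. The second takes for \<open>d\<close> the minimum degree.
  The first takes \<open>d = 2k\<close>: the edge bound leaves no room for a vertex of smaller degree, because
  the remaining \<open>n - 1\<close> vertices span at most \<open>(n - 1) choose 2\<close> edges.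
\<close>

section \<open>Systems of distinct representatives\<close>

text \<open>
  Hall's theorem, by the argument of Halmos and Vaughan. If some nonempty proper subfamily is tight,
  represent it first and delete its union from the other sets; tightness is what keeps Hall's
  condition true there. If none is tight, every proper subfamily has one element to spare, so an
  arbitrary element may be used up for one of the sets.
\<close>

lemma hall_distinct_representatives:
  assumes "finite I" and "\<And>i. i \<in> I \<Longrightarrow> finite (A i)"
    and "\<And>J. J \<subseteq> I \<Longrightarrow> card J \<le> card (\<Union> (A ` J))"
  shows "\<exists>f. inj_on f I \<and> (\<forall>i\<in>I. f i \<in> A i)"
  using assms
proof (induction "card I" arbitrary: I A rule: less_induct)
  case less
  note fin = less.prems(1) and finA = less.prems(2) and hall = less.prems(3)
  show ?case
  proof (cases "\<exists>J. J \<subset> I \<and> J \<noteq> {} \<and> card (\<Union> (A ` J)) \<le> card J")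
    case True
    then obtain J where J: "J \<subset> I" "J \<noteq> {}" "card (\<Union> (A ` J)) \<le> card J"
      by blast
    let ?U = "\<Union> (A ` J)"
    have finJ: "finite J"
      using J(1) fin by (meson finite_subset psubset_imp_subset)
    have finU: "finite ?U"
      using J(1) finJ finA by auto
    have "card J < card I"
      using J(1) fin by (simp add: psubset_card_mono)
    from less.hyps[OF this finJ, of A] obtain f
      where f: "inj_on f J" "\<forall>i\<in>J. f i \<in> A i"
      using J(1) finA hall by (meson psubset_imp_subset subset_trans subsetD)
    have card_less: "card (I - J) < card I"
      using J(1,2) fin by (intro psubset_card_mono) auto
    have hall': "card K \<le> card (\<Union> ((\<lambda>i. A i - ?U) ` K))" if K: "K \<subseteq> I - J" for K
    proof -
      have finK: "finite K" using K fin by (meson finite_Diff finite_subset)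
      have finUK: "finite (\<Union> ((\<lambda>i. A i - ?U) ` K))"
        using finK K finA by auto
      have "card K + card J = card (K \<union> J)"
        using K finK finJ by (subst card_Un_disjoint) auto
      also have "\<dots> \<le> card (\<Union> (A ` (K \<union> J)))"
        using K J(1) by (intro hall) auto
      also have "\<Union> (A ` (K \<union> J)) = \<Union> ((\<lambda>i. A i - ?U) ` K) \<union> ?U"
        by auto
      also have "card \<dots> = card (\<Union> ((\<lambda>i. A i - ?U) ` K)) + card ?U"
        using finUK finU by (intro card_Un_disjoint) auto
      finally show ?thesis using J(3) by linarith
    qed
    obtain g where g: "inj_on g (I - J)" "\<forall>i\<in>I - J. g i \<in> A i - ?U"
      using less.hyps[OF card_less, of "\<lambda>i. A i - ?U"] fin finA hall' by auto
    have "inj_on (\<lambda>i. if i \<in> J then f i else g i) I"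
      using f g unfolding inj_on_def by (smt (verit) DiffD2 DiffI UN_I)
    moreover have "\<forall>i\<in>I. (if i \<in> J then f i else g i) \<in> A i"
      using f g by auto
    ultimately show ?thesis by blast
  next
    case no_tight: False
    show ?thesis
    proof (cases "I = {}")
      case True
      then show ?thesis by simp
    next
      case False
      then obtain i where i: "i \<in> I" by blast
      then have "A i \<noteq> {}" using hall[of "{i}"] by auto
      then obtain x where x: "x \<in> A i" by blast
      have card_less: "card (I - {i}) < card I"
        using fin i by (rule card_Diff1_less)
      have hall': "card K \<le> card (\<Union> ((\<lambda>j. A j - {x}) ` K))" if K: "K \<subseteq> I - {i}" for K
      proof (cases "K = {}")
        case False
        moreover have "K \<subset> I" using K i by blast
        ultimately have "card K < card (\<Union> (A ` K))"
          using no_tight by (meson linorder_not_le)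
        moreover have "\<Union> ((\<lambda>j. A j - {x}) ` K) = \<Union> (A ` K) - {x}"
          by auto
        ultimately show ?thesis
          by (cases "x \<in> \<Union> (A ` K)") simp_all
      qed simp
      obtain g where g: "inj_on g (I - {i})" "\<forall>j\<in>I - {i}. g j \<in> A j - {x}"
        using less.hyps[OF card_less, of "\<lambda>j. A j - {x}"] fin finA hall' by auto
      have "inj_on (g(i := x)) I"
        using g unfolding inj_on_def by auto
      moreover have "\<forall>j\<in>I. (g(i := x)) j \<in> A j"
        using g x by auto
      ultimately show ?thesis by blast
    qed
  qed
qed

section \<open>Neighbourhoods and matchings\<close>

definition neighbours :: "'a graph \<Rightarrow> 'a \<Rightarrow> 'a set" where
  "neighbours G v = {w. {v, w} \<in> edges G}"

lemma edge_subset: "finite_simple_graph G \<Longrightarrow> e \<in> edges G \<Longrightarrow> e \<subseteq> verts G"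
  by (simp add: finite_simple_graph_def)

lemma edge_card: "finite_simple_graph G \<Longrightarrow> e \<in> edges G \<Longrightarrow> card e = 2"
  by (simp add: finite_simple_graph_def)

lemma finite_verts: "finite_simple_graph G \<Longrightarrow> finite (verts G)"
  by (simp add: finite_simple_graph_def)

lemma finite_edges: "finite_simple_graph G \<Longrightarrow> finite (edges G)"
  by (rule finite_subset[of _ "Pow (verts G)"]) (auto simp: finite_simple_graph_def)

lemma edge_distinct: "finite_simple_graph G \<Longrightarrow> {v, w} \<in> edges G \<Longrightarrow> v \<noteq> w"
  using edge_card[of G "{v, w}"] by auto

lemma card_neighbours:
  assumes "finite_simple_graph G"
  shows "card (neighbours G v) = degree G v"
proof -
  have "(\<lambda>w. {v, w}) ` neighbours G v = incident_edges G v"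
  proof (intro equalityI subsetI)
    fix e assume "e \<in> incident_edges G v"
    then have e: "e \<in> edges G" "v \<in> e" by (auto simp: incident_edges_def)
    then obtain x y where "e = {x, y}"
      using edge_card[OF assms] by (meson card_2_iff)
    then obtain w where "e = {v, w}" using e(2) by auto
    then show "e \<in> (\<lambda>w. {v, w}) ` neighbours G v"
      using e(1) by (auto simp: neighbours_def)
  qed (auto simp: neighbours_def incident_edges_def)
  moreover have "inj_on (\<lambda>w. {v, w}) (neighbours G v)"
    by (auto simp: inj_on_def doubleton_eq_iff)
  ultimately show ?thesis
    unfolding degree_def by (metis card_image)
qed

lemma matching_covers:
  assumes "finite_simple_graph G" "k_matching k G M"
  shows "\<Union> M \<subseteq> verts G" and "card (\<Union> M) = 2 * k"
proof -
  have M: "M \<subseteq> edges G" "finite M" "card M = k" "disjoint M"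
    using assms(2) by (auto simp: k_matching_def)
  show "\<Union> M \<subseteq> verts G"
    using M(1) edge_subset[OF assms(1)] by blast
  have c: "card e = 2" if "e \<in> M" for e
    using M(1) that edge_card[OF assms(1)] by blast
  then have "\<And>e. e \<in> M \<Longrightarrow> finite e"
    by (metis card.infinite zero_neq_numeral)
  then have "card (\<Union> M) = (\<Sum>e\<in>M. card e)"
    using M(4) by (simp add: card_Union_disjoint)
  also have "\<dots> = 2 * k" using c M(3) by simp
  finally show "card (\<Union> M) = 2 * k" .
qed

text \<open>
  A smaller matching can be enlarged greedily: it covers at most \<open>2k - 2\<close> vertices, too few to cover
  all vertices or all neighbours of an uncovered one.
\<close>

lemma matching_exists:
  assumes G: "finite_simple_graph G"
    and deg: "\<And>v. v \<in> verts G \<Longrightarrow> 2 * k \<le> degree G v"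
    and "2 * k \<le> card (verts G)"
  shows "\<exists>M. k_matching k G M"
proof -
  have "\<exists>M. k_matching j G M" if "j \<le> k" for j
    using that
  proof (induction j)
    case 0
    show ?case by (auto simp: k_matching_def intro: exI[of _ "{}"])
  next
    case (Suc j)
    then obtain M where M: "k_matching j G M" by auto
    note cov = matching_covers[OF G M]
    have finM: "finite (\<Union> M)"
      using cov(1) finite_verts[OF G] by (rule finite_subset)
    have "\<not> verts G \<subseteq> \<Union> M"
      using card_mono[OF finM, of "verts G"] cov(2) assms(3) Suc.prems by auto
    then obtain v where v: "v \<in> verts G" "v \<notin> \<Union> M" by blast
    have "\<not> neighbours G v \<subseteq> \<Union> M"
      using card_mono[OF finM, of "neighbours G v"] cov(2) deg[OF v(1)] Suc.prems
        card_neighbours[OF G, of v] by auto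
    then obtain w where w: "{v, w} \<in> edges G" "w \<notin> \<Union> M"
      by (auto simp: neighbours_def)
    have "{v, w} \<notin> M" using v by blast
    then have "k_matching (Suc j) G (insert {v, w} M)"
      using M v w by (auto simp: k_matching_def disjoint_def)
    then show ?case by blast
  qed
  then show ?thesis by blast
qed

section \<open>Fractional perfect matchings from permutations\<close>

text \<open>
  On a finite set the injection \<open>f\<close> is a permutation. Its cycles cover the vertices outside \<open>M\<close>, and
  every such vertex \<open>v\<close> receives one half from each of \<open>{v, f v}\<close> and \<open>{u, v}\<close>, where \<open>f u = v\<close>.
\<close>

lemma fractional_matching_from_injection:
  assumes G: "finite_simple_graph G" and M: "k_matching k G M"
    and inj: "inj_on f (verts G - \<Union> M)"
    and adj: "\<And>v. v \<in> verts G - \<Union> M \<Longrightarrow> f v \<in> verts G - \<Union> M \<and> {v, f v} \<in> edges G"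
  shows "\<exists>h. fractional_perfect_matching G h \<and> (\<forall>e\<in>M. h e = 1)"
proof -
  define W where "W = verts G - \<Union> M"
  define F where "F e = {v \<in> W. {v, f v} = e}" for e
  \<comment> \<open>Counting the vertices that generate \<open>e\<close>, rather than testing whether there is one, gives
    weight one to the edge of a cycle of length two.\<close>
  define h :: "'a set \<Rightarrow> real" where "h e = (if e \<in> M then 1 else card (F e) / 2)" for e
  have finW: "finite W" using finite_verts[OF G] by (simp add: W_def)
  have ME: "M \<subseteq> edges G" and disj: "disjoint M"
    using M by (auto simp: k_matching_def)
  have bij: "bij_betw f W W"
    unfolding bij_betw_def using endo_inj_surj[of W f] inj adj finW
    unfolding W_def by blast
  have F_empty: "F e = {}" if "v \<in> e" "v \<notin> W" for e v
    using that adj unfolding F_def W_def by blast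
  have inc_fin: "finite (incident_edges G v)" for v
    using finite_edges[OF G] by (simp add: incident_edges_def)
  \<comment> \<open>Only the two endpoints of an edge can generate it.\<close>
  have h_le: "h e \<le> 1" if "e \<in> edges G" for e
  proof -
    have "card e = 2" using edge_card[OF G that] .
    moreover from this have "finite e" by (metis card.infinite zero_neq_numeral)
    moreover have "F e \<subseteq> e" by (auto simp: F_def)
    ultimately have "card (F e) \<le> 2" by (metis card_mono)
    then show ?thesis by (simp add: h_def)
  qed
  have sum_uncovered: "(\<Sum>e\<in>incident_edges G v. h e) = 1" if v: "v \<in> W" for v
  proof -
    obtain u where u: "u \<in> W" "f u = v"
      using bij v by (metis bij_betw_iff_bijections)
    have "u \<noteq> v"
      using u adj edge_distinct[OF G] unfolding W_def by metis
    have "(\<Sum>e\<in>incident_edges G v. h e) = (\<Sum>e\<in>incident_edges G v. card (F e)) / 2"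
      unfolding sum_divide_distrib of_nat_sum
      by (rule sum.cong) (use v in \<open>auto simp: h_def incident_edges_def W_def\<close>)
    also have "(\<Sum>e\<in>incident_edges G v. card (F e)) = card (\<Union>e\<in>incident_edges G v. F e)"
      by (rule card_UN_disjoint[symmetric]) (use inc_fin finW in \<open>auto simp: F_def\<close>)
    also have "(\<Union>e\<in>incident_edges G v. F e) = {v, u}"
    proof (intro equalityI subsetI)
      fix x assume "x \<in> (\<Union>e\<in>incident_edges G v. F e)"
      then have "x \<in> W" "v \<in> {x, f x}" by (auto simp: F_def incident_edges_def)
      then show "x \<in> {v, u}"
        using u bij by (auto simp: bij_betw_def inj_on_def)
    next
      fix x assume "x \<in> {v, u}"
      then have "x \<in> W" "v \<in> {x, f x}" using u v by auto
      then show "x \<in> (\<Union>e\<in>incident_edges G v. F e)"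
        using adj by (auto simp: F_def incident_edges_def W_def)
    qed
    also have "real (card {v, u}) / 2 = 1" using \<open>u \<noteq> v\<close> by simp
    finally show ?thesis .
  qed
  have sum_covered: "(\<Sum>e\<in>incident_edges G v. h e) = 1" if v: "v \<in> \<Union> M" for v
  proof -
    obtain m where m: "m \<in> M" "v \<in> m" using v by blast
    have only: "e \<notin> M" if "e \<in> incident_edges G v - {m}" for e
      using that m disj by (auto simp: disjoint_def incident_edges_def)
    have "h e = 0" if "e \<in> incident_edges G v - {m}" for e
      using only[OF that] F_empty[of v e] that v by (auto simp: h_def incident_edges_def W_def)
    moreover have "m \<in> incident_edges G v"
      using m ME by (auto simp: incident_edges_def)
    ultimately have "(\<Sum>e\<in>incident_edges G v. h e) = h m"
      using inc_fin by (simp add: sum.remove)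
    then show ?thesis using m by (simp add: h_def)
  qed
  have "fractional_perfect_matching G h"
    unfolding fractional_perfect_matching_def
    using h_le sum_uncovered sum_covered by (auto simp: W_def h_def)
  moreover have "\<forall>e\<in>M. h e = 1" by (simp add: h_def)
  ultimately show ?thesis by blast
qed

text \<open>
  Let \<open>X\<close> violate Hall's condition for the neighbourhoods outside \<open>M\<close>, and let \<open>U\<close> be the union of
  these neighbourhoods. Removing \<open>X \<inter> U\<close> from both sets keeps the inequality and leaves the
  independent set \<open>X - U\<close>, whose neighbours outside \<open>M\<close> all lie in \<open>U - X\<close>. Adding the \<open>2k\<close> vertices
  of \<open>M\<close> to \<open>U - X\<close> gives \<open>S\<close>. Discarding surplus vertices of \<open>X - U\<close> makes the cardinality of \<open>I\<close> a
  function of that of \<open>S\<close>, so that later only one parameter varies.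
\<close>

lemma barrier_of_unextendable_matching:
  assumes G: "finite_simple_graph G" and M: "k_matching k G M"
    and unext: "\<not> (\<exists>h. fractional_perfect_matching G h \<and> (\<forall>e\<in>M. h e = 1))"
  shows "\<exists>S I. S \<subseteq> verts G \<and> I \<subseteq> verts G \<and> S \<inter> I = {} \<and> 2 * k \<le> card S \<and>
           card I + 2 * k = card S + 1 \<and>
           (\<forall>e\<in>edges G. e \<inter> I \<noteq> {} \<longrightarrow> e \<inter> S \<noteq> {})"
proof -
  define W where "W = verts G - \<Union> M"
  define N where "N v = neighbours G v \<inter> W" for v
  have finW: "finite W" using finite_verts[OF G] by (simp add: W_def)
  have finN: "finite (N v)" for v using finW by (simp add: N_def)
  have "\<not> (\<exists>f. inj_on f W \<and> (\<forall>v\<in>W. f v \<in> N v))"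
    using fractional_matching_from_injection[OF G M] unext
    unfolding W_def N_def neighbours_def by blast
  then obtain X where X: "X \<subseteq> W" "card (\<Union> (N ` X)) < card X"
    using hall_distinct_representatives[OF finW, of N] finN by (meson linorder_not_le)
  let ?U = "\<Union> (N ` X)"
  have finX: "finite X" and finU: "finite ?U"
    using X(1) finW finN by (auto intro: finite_subset)
  have "card (?U - X) < card (X - ?U)"
    using X(2) finX finU card_Int_Diff[of ?U X] card_Int_Diff[of X ?U]
    by (simp add: Int_commute)
  then obtain I where I: "I \<subseteq> X - ?U" "card I = card (?U - X) + 1"
    by (metis Suc_eq_plus1 Suc_leI obtain_subset_with_card_n)
  define S where "S = \<Union> M \<union> (?U - X)"
  note cov = matching_covers[OF G M]
  have finM: "finite (\<Union> M)" using cov(1) finite_verts[OF G] by (rule finite_subset)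
  have UW: "?U \<subseteq> W" by (auto simp: N_def)
  have cardS: "card S = 2 * k + card (?U - X)"
    unfolding S_def using finM finU UW cov(2)
    by (subst card_Un_disjoint) (auto simp: W_def)
  have "e \<inter> S \<noteq> {}" if e: "e \<in> edges G" "e \<inter> I \<noteq> {}" for e
  proof -
    obtain x y where xy: "e = {x, y}" "x \<in> I"
      using e edge_card[OF G e(1)] by (auto simp: card_2_iff)
    show ?thesis
    proof (cases "y \<in> \<Union> M")
      case False
      have "y \<in> W" using False edge_subset[OF G e(1)] xy by (auto simp: W_def)
      then have "y \<in> N x" using e xy by (auto simp: N_def neighbours_def)
      then have "y \<in> ?U" using xy I(1) by blast
      \<comment> \<open>Otherwise \<open>x\<close>, being a neighbour of \<open>y\<close>, would lie in the union that \<open>I\<close> avoids.\<close>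
      moreover have "y \<notin> X"
      proof
        assume "y \<in> X"
        moreover have "x \<in> N y"
          using e xy I(1) X(1) by (auto simp: N_def neighbours_def insert_commute)
        ultimately show False using xy I(1) by blast
      qed
      ultimately show ?thesis using xy by (auto simp: S_def)
    qed (use xy in \<open>auto simp: S_def\<close>)
  qed
  moreover have "S \<subseteq> verts G" "I \<subseteq> verts G" "S \<inter> I = {}"
    using cov(1) UW I(1) X(1) by (auto simp: S_def W_def)
  ultimately show ?thesis
    using cardS I(2) by (intro exI[of _ S] exI[of _ I]) auto
qed

section \<open>The graphs saturating a barrier\<close>

text \<open>
  For disjoint \<open>S\<close> and \<open>I\<close> these are the edges of \<open>K\<^sub>s \<or> (K\<^sub>r \<union> t K\<^sub>1)\<close> with \<open>S\<close> as the dominating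
  clique and \<open>I\<close> as the isolated vertices: a pair is missing exactly when it meets \<open>I\<close> but not \<open>S\<close>.
  The single condition replaces the nested sum types of the join and makes the count, the inclusion
  of \<open>G\<close>, and the isomorphism uniform.
\<close>

definition barrier_edges :: "'a set \<Rightarrow> 'a set \<Rightarrow> 'a set \<Rightarrow> 'a set set" where
  "barrier_edges V S I = {e. e \<subseteq> V \<and> card e = 2 \<and> (e \<inter> I \<noteq> {} \<longrightarrow> e \<inter> S \<noteq> {})}"

lemma pair_in_barrier_edges:
  "{x, y} \<in> barrier_edges V S I \<longleftrightarrow>
     x \<noteq> y \<and> x \<in> V \<and> y \<in> V \<and> (x \<in> I \<or> y \<in> I \<longrightarrow> x \<in> S \<or> y \<in> S)"
  by (auto simp: barrier_edges_def card_insert_if)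

lemma card_barrier_edges:
  assumes "finite V" "S \<subseteq> V" "I \<subseteq> V" "S \<inter> I = {}"
  shows "card (barrier_edges V S I) = (card V - card I choose 2) + card S * card I"
proof -
  let ?A = "{e. e \<subseteq> V - I \<and> card e = 2}" and ?B = "(\<lambda>(u, v). {u, v}) ` (S \<times> I)"
  have fin: "finite S" "finite I" using assms by (auto intro: finite_subset)
  have "barrier_edges V S I = ?A \<union> ?B"
  proof (intro equalityI subsetI)
    fix e assume e: "e \<in> barrier_edges V S I"
    then obtain x y where xy: "e = {x, y}"
      by (auto simp: barrier_edges_def card_2_iff)
    show "e \<in> ?A \<union> ?B"
    proof (cases "e \<inter> I = {}")
      case False
      then have "x \<in> S \<and> y \<in> I \<or> y \<in> S \<and> x \<in> I"
        using e assms(4) unfolding xy pair_in_barrier_edges by auto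
      then show ?thesis unfolding xy by (auto simp: insert_commute image_iff)
    qed (use e in \<open>auto simp: barrier_edges_def\<close>)
  qed (use assms in \<open>auto simp: barrier_edges_def card_insert_if\<close>)
  moreover have "card (?A \<union> ?B) = card ?A + card ?B"
    using assms(1) fin by (intro card_Un_disjoint) auto
  moreover have "card ?A = (card V - card I choose 2)"
    using assms fin by (simp add: n_subsets card_Diff_subset)
  moreover have "card ?B = card S * card I"
    using assms(4)
    by (subst card_image) (auto simp: inj_on_def doubleton_eq_iff card_cartesian_product)
  ultimately show ?thesis by simp
qed

abbreviation barrier_graph :: "nat \<Rightarrow> nat \<Rightarrow> nat \<Rightarrow> (nat + nat + nat) graph" where
  "barrier_graph s r t \<equiv> graph_join (complete_graph s)
     (graph_union (complete_graph r) (edgeless_graph t))"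

lemma verts_barrier_graph: "verts (barrier_graph s r t) = {..<s} <+> ({..<r} <+> {..<t})"
  by (simp add: graph_join_def graph_union_def complete_graph_def edgeless_graph_def)

lemma edges_barrier_graph:
  "edges (barrier_graph s r t) =
     barrier_edges (verts (barrier_graph s r t)) (Inl ` {..<s}) (Inr ` Inr ` {..<t})"
  (is "?E = ?B")
proof (intro equalityI subsetI)
  fix e assume "e \<in> ?E"
  then show "e \<in> ?B"
    unfolding verts_barrier_graph
    by (auto simp: graph_join_def graph_union_def complete_graph_def edgeless_graph_def
        barrier_edges_def card_image card_insert_if)
next
  fix e assume e: "e \<in> ?B"
  then obtain x y where xy: "e = {x, y}" by (auto simp: barrier_edges_def card_2_iff)
  have pairs: "\<And>f i j. f ` {i, j} = {f i, f j}" by simp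
  have join: "{Inl i, Inl j} \<in> ?E" if "i \<noteq> j" "i < s" "j < s" for i j
    using that imageI[of "{i, j}" "{e. e \<subseteq> {..<s} \<and> card e = 2}"
        "(`) (Inl :: nat \<Rightarrow> nat + nat + nat)"]
    by (simp add: graph_join_def graph_union_def complete_graph_def)
  have cross: "{Inl i, Inr z} \<in> ?E" if "i < s" "z \<in> {..<r} <+> {..<t}" for i z
    using that by (auto simp: graph_join_def graph_union_def complete_graph_def edgeless_graph_def)
  have rest: "{Inr (Inl i), Inr (Inl j)} \<in> ?E" if "i \<noteq> j" "i < r" "j < r" for i j
    using that imageI[OF imageI[of "{i, j}" "{e. e \<subseteq> {..<r} \<and> card e = 2}" 
          "(`) (Inl :: nat \<Rightarrow> nat + nat)"], of "(`) (Inr :: nat + nat \<Rightarrow> nat + nat + nat)"]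
    by (simp add: graph_join_def graph_union_def complete_graph_def edgeless_graph_def)
  have "x \<noteq> y" "x \<in> {..<s} <+> ({..<r} <+> {..<t})" "y \<in> {..<s} <+> ({..<r} <+> {..<t})"
    "x \<in> Inr ` Inr ` {..<t} \<or> y \<in> Inr ` Inr ` {..<t} \<longrightarrow> x \<in> Inl ` {..<s} \<or> y \<in> Inl ` {..<s}"
    using e unfolding xy pair_in_barrier_edges verts_barrier_graph by auto
  then show "e \<in> ?E"
    unfolding xy
    by (elim PlusE) (auto simp: join rest intro: cross cross[THEN back_subst[of "\<lambda>p. p \<in> ?E", OF _ insert_commute]])
qed

lemma num_edges_barrier_graph:
  "num_edges (barrier_graph s r t) = (s + r choose 2) + s * t"
proof -
  have fin: "finite (verts (barrier_graph s r t))"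
    by (simp add: verts_barrier_graph)
  have cards: "card (verts (barrier_graph s r t)) = s + (r + t)"
    "card (Inl ` {..<s} :: (nat + nat + nat) set) = s"
    "card (Inr ` Inr ` {..<t} :: (nat + nat + nat) set) = t"
    by (simp_all add: verts_barrier_graph card_Plus card_image)
  show ?thesis
    unfolding num_edges_def edges_barrier_graph
    by (subst card_barrier_edges[OF fin], unfold cards) (auto simp: verts_barrier_graph)
qed

lemma barrier_graph_iso:
  assumes "finite (verts G)" "S \<subseteq> verts G" "I \<subseteq> verts G" "S \<inter> I = {}"
    and "edges G = barrier_edges (verts G) S I"
    and "card S = s" "card I = t" "card (verts G) = s + r + t"
  shows "graph_iso G (barrier_graph s r t)"
proof -
  define R where "R = verts G - (S \<union> I)"
  have fin: "finite S" "finite I" "finite R"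
    using assms by (auto simp: R_def intro: finite_subset)
  have "card R = r"
    using assms fin by (simp add: R_def card_Diff_subset card_Un_disjoint)
  then obtain a b c where "bij_betw a S {..<s}" "bij_betw b R {..<r}" "bij_betw c I {..<t}"
    using fin assms(6,7) by (metis bij_betw_iff_card card_lessThan finite_lessThan)
  moreover define f :: "'a \<Rightarrow> nat + nat + nat" where
    "f x = (if x \<in> S then Inl (a x) else if x \<in> I then Inr (Inr (c x)) else Inr (Inl (b x)))" for x
  moreover have "x \<notin> S" if "x \<in> I" for x using that assms(4) by blast
  ultimately have f: "bij_betw f S (Inl ` {..<s})" "bij_betw f R (Inr ` Inl ` {..<r})"
      "bij_betw f I (Inr ` Inr ` {..<t})"
    using assms(4) by (auto simp: bij_betw_def inj_on_def R_def image_iff)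
  have "bij_betw f (S \<union> (R \<union> I)) (Inl ` {..<s} \<union> (Inr ` Inl ` {..<r} \<union> Inr ` Inr ` {..<t}))"
    using f by (intro bij_betw_combine) auto
  moreover have "S \<union> (R \<union> I) = verts G" using assms(2,3) by (auto simp: R_def)
  moreover have "Inl ` {..<s} \<union> (Inr ` Inl ` {..<r} \<union> Inr ` Inr ` {..<t}) = verts (barrier_graph s r t)"
    by (auto simp: verts_barrier_graph)
  ultimately have bij: "bij_betw f (verts G) (verts (barrier_graph s r t))" by simp
  have memS: "f x \<in> Inl ` {..<s} \<longleftrightarrow> x \<in> S" and memI: "f x \<in> Inr ` Inr ` {..<t} \<longleftrightarrow> x \<in> I"
    if "x \<in> verts G" for x
    using inj_on_image_mem_iff[OF _ that assms(2), of f] inj_on_image_mem_iff[OF _ that assms(3), of f]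
      bij f(1,3) by (simp_all add: bij_betw_def)
  have "{x, y} \<in> edges G \<longleftrightarrow> {f x, f y} \<in> edges (barrier_graph s r t)"
    if "x \<in> verts G" "y \<in> verts G" for x y
  proof -
    have "f x \<in> verts (barrier_graph s r t)" "f y \<in> verts (barrier_graph s r t)"
      "f x = f y \<longleftrightarrow> x = y"
      using bij that by (auto simp: bij_betw_def inj_on_def)
    then show ?thesis
      unfolding assms(5) edges_barrier_graph pair_in_barrier_edges
      using that memS memI by simp
  qed
  with bij show ?thesis unfolding graph_iso_def by blast
qed

section \<open>Edge counts\<close>

text \<open>
  With \<open>s = t + 2k - 1\<close>, twice the edge number is \<open>n (n - 1) - 2 t (n - 2k + 1) + 3 t\<^sup>2 + t\<close>. The
  difference of its values at \<open>t0\<close> and \<open>t\<close> has the factor \<open>t - t0\<close>, and the other factor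
  \<open>2 (n - 2k + 1) - 3 (t + t0) - 1\<close> is positive because \<open>2 t \<le> n - 2k + 1\<close>
  and the hypothesis on \<open>n\<close> reads \<open>6 t0 < n - 2k - 1\<close>.
\<close>

lemma barrier_edge_count_strict:
  fixes n k d s t t0 :: nat
  assumes "2 * k \<le> d" "d < s" "t + 2 * k = s + 1" "t0 + 2 * k = d + 1" "s + t \<le> n"
    and "6 * d + 8 \<le> n + 10 * k"
  shows "(n - t choose 2) + s * t < (n - t0 choose 2) + d * t0"
proof -
  have c: "2 * int (m choose 2) = int m * (int m - 1)" for m
    by (induction m) (auto simp: numeral_2_eq_2 algebra_simps)
  let ?f = "\<lambda>t s. (n - t choose 2) + s * t"
  have t: "t0 < t" "t0 \<le> n" "t \<le> n" "2 * t + 2 * k \<le> n + 1" using assms by auto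
  have double: "2 * int (?f t s) =
      int n * (int n - 1) - 2 * int t * (int n - 2 * int k + 1) + 3 * int t * int t + int t"
    if "t \<le> n" "int s = int t + 2 * int k - 1" for t s
  proof -
    have "2 * int (?f t s) = 2 * int (n - t choose 2) + 2 * int s * int t" by simp
    then show ?thesis
      unfolding c that(2) of_nat_diff[OF that(1)] by (simp add: algebra_simps)
  qed
  have s: "int s = int t + 2 * int k - 1" and d: "int d = int t0 + 2 * int k - 1"
    using assms(3,4) by linarith+
  have "3 * (int t + int t0) + 1 < 2 * (int n - 2 * int k + 1)"
  proof -
    have "2 * int t + 2 * int k \<le> int n + 1" "6 * int d + 8 \<le> int n + 10 * int k"
      using t(4) assms(6) by linarith+
    then show ?thesis using d by (simp add: algebra_simps)
  qed
  then have "0 < (int t - int t0) * (2 * (int n - 2 * int k + 1) - 3 * (int t + int t0) - 1)"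
    using t(1) by (intro mult_pos_pos) auto
  also have "\<dots> = 2 * int (?f t0 d) - 2 * int (?f t s)"
    unfolding double[OF t(3) s] double[OF t(2) d] by (simp add: algebra_simps)
  finally have "0 < 2 * int (?f t0 d) - 2 * int (?f t s)" .
  moreover have "b < a" if "0 < 2 * int a - 2 * int b" for a b :: nat using that by simp
  ultimately show ?thesis by blast
qed

text \<open>
  A barrier has at least \<open>d\<close> vertices in \<open>S\<close>; more than \<open>d\<close> would leave \<open>G\<close> with too few edges. With
  exactly \<open>d\<close>, the edge bound forces every edge that the barrier permits. The number of
  remaining vertices is written \<open>n + 2k - 2d - 1\<close>, with the subtractions last, since for \<open>d = 2k\<close>
  the order may be smaller than \<open>2d\<close> and \<open>n - 2d\<close> would be truncated.
\<close>

lemma extendable_or_barrier_graph: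
  assumes G: "finite_simple_graph G" and "order G = n"
    and deg: "\<And>v. v \<in> verts G \<Longrightarrow> d \<le> degree G v" and "2 * k \<le> d"
    and large: "6 * d + 8 \<le> n + 10 * k"
    and dense: "num_edges G \<ge> num_edges (barrier_graph d (n + 2 * k - 2 * d - 1) (d - 2 * k + 1))"
  shows "fractional_extendable k G \<or>
    graph_iso G (barrier_graph d (n + 2 * k - 2 * d - 1) (d - 2 * k + 1))"
proof (rule disjCI)
  let ?r = "n + 2 * k - 2 * d - 1" and ?t = "d - 2 * k + 1"
  assume niso: "\<not> graph_iso G (barrier_graph d ?r ?t)"
  have n: "card (verts G) = n" using \<open>order G = n\<close> by (simp add: order_def)
  have "2 * k + 2 \<le> n" using \<open>2 * k \<le> d\<close> large by linarith
  moreover have "\<exists>M. k_matching k G M"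
  proof (rule matching_exists[OF G])
    show "2 * k \<le> degree G v" if "v \<in> verts G" for v
      using deg[OF that] \<open>2 * k \<le> d\<close> by linarith
    show "2 * k \<le> card (verts G)" using calculation n by linarith
  qed
  moreover have "\<exists>h. fractional_perfect_matching G h \<and> (\<forall>e\<in>M. h e = 1)"
    if M: "k_matching k G M" for M
  proof (rule ccontr)
    assume "\<not> ?thesis"
    from barrier_of_unextendable_matching[OF G M this] obtain S I where
      S: "S \<subseteq> verts G" and I: "I \<subseteq> verts G" and disj: "S \<inter> I = {}" and "2 * k \<le> card S"
      and card: "card I + 2 * k = card S + 1"
      and bar: "\<forall>e\<in>edges G. e \<inter> I \<noteq> {} \<longrightarrow> e \<inter> S \<noteq> {}"
      by (elim exE conjE)
    have fin: "finite S" "finite I" using S I finite_verts[OF G] by (auto intro: finite_subset)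
    have sub: "edges G \<subseteq> barrier_edges (verts G) S I"
      using bar edge_subset[OF G] edge_card[OF G] by (auto simp: barrier_edges_def)
    have finB: "finite (barrier_edges (verts G) S I)"
      by (rule finite_subset[of _ "Pow (verts G)"])
        (use finite_verts[OF G] in \<open>auto simp: barrier_edges_def\<close>)
    note cardB = card_barrier_edges[OF finite_verts[OF G] S I disj]
    have le: "num_edges G \<le> (n - card I choose 2) + card S * card I"
      using card_mono[OF finB sub] unfolding num_edges_def cardB n .
    have total: "card S + card I \<le> n"
      using card_mono[of "verts G" "S \<union> I"] S I finite_verts[OF G] fin disj n
      by (simp add: card_Un_disjoint)
    \<comment> \<open>The cardinality of \<open>I\<close> is positive, and a vertex of \<open>I\<close> has at least \<open>d\<close> neighbours.\<close>
    have "d \<le> card S"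
    proof -
      have "I \<noteq> {}" using card \<open>2 * k \<le> card S\<close> by auto
      then obtain v where v: "v \<in> I" by blast
      have "neighbours G v \<subseteq> S"
        using bar v disj by (fastforce simp: neighbours_def)
      then have "degree G v \<le> card S"
        using card_mono[OF fin(1)] card_neighbours[OF G, of v] by metis
      then show ?thesis using deg v I by (meson le_trans subsetD)
    qed
    have parts: "d + ?r = n - ?t" using \<open>2 * k \<le> d\<close> \<open>d \<le> card S\<close> card total by linarith
    have ge: "(n - ?t choose 2) + d * ?t \<le> num_edges G"
      using dense unfolding num_edges_barrier_graph parts .
    have "\<not> d < card S"
      using barrier_edge_count_strict[OF \<open>2 * k \<le> d\<close> _ card _ total large, of ?t] le ge
        \<open>2 * k \<le> d\<close> by auto
    then have cards: "card S = d" "card I = ?t"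
      using \<open>d \<le> card S\<close> \<open>2 * k \<le> d\<close> card by linarith+
    have "edges G = barrier_edges (verts G) S I"
    proof (rule card_subset_eq[OF finB sub])
      show "card (edges G) = card (barrier_edges (verts G) S I)"
        using le ge unfolding cardB n cards num_edges_def by (rule antisym)
    qed
    moreover have "card (verts G) = d + ?r + ?t"
      using n parts total cards by linarith
    ultimately have "graph_iso G (barrier_graph d ?r ?t)"
      using barrier_graph_iso[OF finite_verts[OF G] S I disj] cards by blast
    then show False using niso by blast
  qed
  ultimately show "fractional_extendable k G"
    using \<open>order G = n\<close> by (auto simp: fractional_extendable_def)
qed

lemma num_edges_le_degree:
  assumes G: "finite_simple_graph G" and v: "v \<in> verts G"
  shows "num_edges G \<le> (order G - 1 choose 2) + degree G v"
proof -
  let ?A = "{e. e \<subseteq> verts G - {v} \<and> card e = 2}"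
  have "edges G \<subseteq> ?A \<union> incident_edges G v"
    using edge_subset[OF G] edge_card[OF G] by (auto simp: incident_edges_def)
  then have "num_edges G \<le> card (?A \<union> incident_edges G v)"
    unfolding num_edges_def using finite_verts[OF G] finite_edges[OF G]
    by (intro card_mono) (auto simp: incident_edges_def)
  also have "\<dots> \<le> card ?A + degree G v"
    unfolding degree_def by (rule card_Un_le)
  also have "card ?A = (order G - 1 choose 2)"
    using finite_verts[OF G] v by (simp add: n_subsets order_def)
  finally show ?thesis .
qed

lemma complete_graph_1: "complete_graph 1 = edgeless_graph 1"
proof -
  have "{e. e \<subseteq> {..<1::nat} \<and> card e = 2} = {}"
    by (auto simp: lessThan_Suc subset_singleton_iff)
  then show ?thesis by (simp add: complete_graph_def edgeless_graph_def)
qed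

theorem theorem1p5:
  fixes k n \<delta> :: nat and G :: "'a graph"
  assumes "k \<ge> 1"
    and "finite_simple_graph G" and "graph_connected G"
    and "order G = n" and "min_degree G = \<delta>"
  shows "(n \<ge> 2 * k + 9 \<and>
      num_edges G \<ge> num_edges (graph_join (complete_graph (2 * k))
        (graph_union (complete_graph (n - 2 * k - 1)) (complete_graph 1)))
      \<longrightarrow> fractional_extendable k G \<or>
        graph_iso G (graph_join (complete_graph (2 * k))
          (graph_union (complete_graph (n - 2 * k - 1)) (complete_graph 1)))) \<and>
    (n \<ge> 6 * \<delta> \<and> \<delta> \<ge> 2 * k + 1 \<and>
      num_edges G \<ge> num_edges (graph_join (complete_graph \<delta>)
        (graph_union (complete_graph (n - 2 * \<delta> + 2 * k - 1)) (edgeless_graph (\<delta> - 2 * k + 1))))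
      \<longrightarrow> fractional_extendable k G \<or>
        graph_iso G (graph_join (complete_graph \<delta>)
          (graph_union (complete_graph (n - 2 * \<delta> + 2 * k - 1)) (edgeless_graph (\<delta> - 2 * k + 1)))))"
proof (intro conjI impI)
  assume a: "n \<ge> 2 * k + 9 \<and>
      num_edges G \<ge> num_edges (graph_join (complete_graph (2 * k))
        (graph_union (complete_graph (n - 2 * k - 1)) (complete_graph 1)))"
  then have dense: "num_edges G \<ge> num_edges (barrier_graph (2 * k) (n - 2 * k - 1) 1)"
    unfolding complete_graph_1 by blast
  \<comment> \<open>The extremal graph has \<open>(n - 1 choose 2) + 2k\<close> edges.\<close>
  have "2 * k \<le> degree G v" if "v \<in> verts G" for v
    using num_edges_le_degree[OF assms(2) that] dense a assms(4)
    by (simp add: num_edges_barrier_graph)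
  moreover have "n + 2 * k - 2 * (2 * k) - 1 = n - 2 * k - 1" "2 * k - 2 * k + 1 = 1"
    by auto
  ultimately show "fractional_extendable k G \<or> graph_iso G (graph_join (complete_graph (2 * k))
          (graph_union (complete_graph (n - 2 * k - 1)) (complete_graph 1)))"
    unfolding complete_graph_1
    using extendable_or_barrier_graph[OF assms(2,4), of "2 * k" k] dense a by auto
next
  assume a: "n \<ge> 6 * \<delta> \<and> \<delta> \<ge> 2 * k + 1 \<and>
      num_edges G \<ge> num_edges (barrier_graph \<delta> (n - 2 * \<delta> + 2 * k - 1) (\<delta> - 2 * k + 1))"
  have "\<delta> \<le> degree G v" if "v \<in> verts G" for v
    using that assms(2,5) finite_verts unfolding min_degree_def by fastforce
  moreover have "n - 2 * \<delta> + 2 * k - 1 = n + 2 * k - 2 * \<delta> - 1"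
    using a by auto
  ultimately show "fractional_extendable k G \<or>
      graph_iso G (barrier_graph \<delta> (n - 2 * \<delta> + 2 * k - 1) (\<delta> - 2 * k + 1))"
    using extendable_or_barrier_graph[OF assms(2,4), of \<delta> k] a assms(1) by auto
qed

end
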